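(* A right P{\l}onka magma $(X,\cdot)$ is right ideal-simple if and only if $X$ is a finite set and there exists an $|X|$-cycle $f:X\to X$ such that $(X,\cdot)=(X,\cdot_f)$, i.e. $x\cdot y=f(x)$ for all $x,y\in X$. Moreover, for every positive integer $n$ and every set $X$ with $|X|=n$, up to isomorphism there is only one right ideal-simple right P{\l}onka magma on $X$, namely the magma $(X,\cdot_f)$ associated to a cycle $f$ of length $n$ in the permutation group $S_n$ of $X$.
   Context: A right P{\l}onka magma is a set $X$ with a binary operation such that $(x\cdot y)\cdot z=(x\cdot z)\cdot y$ and $x\cdot(y\cdot z)=x\cdot y$ for all $x,y,z\in X$. A right ideal of $(X,\cdot)$ is a non-empty subset $J$ with $a\cdot x\in J$ for all $a\in J$, $x\in X$; the magma is right ideal-simple if it has no proper non-empty right ideals. For $f:X\to X$, $\cdot_f$ denotes the operation $x\cdot_f y=f(x)$. A map $f:X\to X$ is called an $|X|$-cycle (or incompressible) if no non-empty proper subset $J\subsetneq X$ satisfies $f(J)\subseteq J$; for $X$ finite and non-empty this means that $f$ is a cyclic permutation of length $|X|$ (the identity if $|X|=1$). *)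

theory Defs
  imports "HOL-Library.FuncSet" "HOL-Combinatorics.Cycles"
begin

text \<open>
  Magmas are given by an explicit carrier \<open>X\<close> (possibly empty) and an operation \<open>m\<close>;
  the values of \<open>m\<close> outside \<open>X\<close> are irrelevant.
\<close>

locale magma =
  fixes X :: "'a set" and m :: "'a \<Rightarrow> 'a \<Rightarrow> 'a"
  assumes closed: "\<lbrakk>x \<in> X; y \<in> X\<rbrakk> \<Longrightarrow> m x y \<in> X"

locale right_plonka_magma = magma +
  assumes right_commute: "\<lbrakk>x \<in> X; y \<in> X; z \<in> X\<rbrakk> \<Longrightarrow> m (m x y) z = m (m x z) y"
    and right_absorb: "\<lbrakk>x \<in> X; y \<in> X; z \<in> X\<rbrakk> \<Longrightarrow> m x (m y z) = m x y"

definition right_ideal :: "'a set \<Rightarrow> ('a \<Rightarrow> 'a \<Rightarrow> 'a) \<Rightarrow> 'a set \<Rightarrow> bool" where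
  "right_ideal X m J \<longleftrightarrow> J \<subseteq> X \<and> J \<noteq> {} \<and> (\<forall>a\<in>J. \<forall>x\<in>X. m a x \<in> J)"

definition right_ideal_simple :: "'a set \<Rightarrow> ('a \<Rightarrow> 'a \<Rightarrow> 'a) \<Rightarrow> bool" where
  "right_ideal_simple X m \<longleftrightarrow> \<not> (\<exists>J. right_ideal X m J \<and> J \<noteq> X)"

definition op_of :: "('a \<Rightarrow> 'a) \<Rightarrow> 'a \<Rightarrow> 'a \<Rightarrow> 'a" where
  "op_of f x y = f x"

text \<open>An \<open>|X|\<close>-cycle, for a self-map of a set \<open>X\<close> that is not assumed finite.\<close>

definition incompressible :: "'a set \<Rightarrow> ('a \<Rightarrow> 'a) \<Rightarrow> bool" where
  "incompressible X f \<longleftrightarrow> f \<in> X \<rightarrow> X \<and> \<not> (\<exists>J. J \<noteq> {} \<and> J \<subset> X \<and> f ` J \<subseteq> J)"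

text \<open>
  Cycles of length \<open>n\<close> in the symmetric group of \<open>X\<close>, as permutations of the whole type
  fixing everything outside \<open>X\<close>. A cycle of length \<open>1\<close> is the identity.
\<close>

definition cycle_of_length :: "'a set \<Rightarrow> nat \<Rightarrow> ('a \<Rightarrow> 'a) \<Rightarrow> bool" where
  "cycle_of_length X n f \<longleftrightarrow>
     (\<exists>cs. cycle cs \<and> set cs \<subseteq> X \<and> length cs = n \<and> f = cycle_of_list cs)"

definition magma_isomorphic ::
    "'a set \<Rightarrow> ('a \<Rightarrow> 'a \<Rightarrow> 'a) \<Rightarrow> 'b set \<Rightarrow> ('b \<Rightarrow> 'b \<Rightarrow> 'b) \<Rightarrow> bool" where
  "magma_isomorphic X m Y k \<longleftrightarrow>
     (\<exists>h. bij_betw h X Y \<and> (\<forall>x\<in>X. \<forall>y\<in>X. h (m x y) = k (h x) (h y)))"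

end

theory Submission
  imports Defs "HOL-Combinatorics.Orbits"
begin

text \<open>
  In a right Plonka magma the law \<open>x \<cdot> (y \<cdot> z) = x \<cdot> y\<close> says that the right translations by
  \<open>y\<close> and by \<open>y \<cdot> z\<close> agree, so the set of elements with a prescribed right translation is a right
  ideal. If the magma is simple, all right translations coincide with a single map \<open>f\<close>, and right
  ideals are the non-empty \<open>f\<close>-invariant subsets. The forward orbit \<open>{f\<^sup>n a | n \<ge> 1}\<close> is invariant, so
  it is all of \<open>X\<close>; as it contains \<open>a\<close>, it is a finite cycle. Two cycles of the same length are
  conjugate, which gives uniqueness.
\<close>

text \<open>\<open>orbit f a\<close> starts at \<open>f a\<close>, so its equality with
  \<open>X\<close> also makes \<open>a\<close> return to itself. The empty set is excluded because
  every map is incompressible on it, whereas \<open>cyclic_on\<close> asks for a point.\<close>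

lemma incompressible_iff_cyclic_on:
  assumes "X \<noteq> {}"
  shows "incompressible X f \<longleftrightarrow> cyclic_on f X"
proof
  assume inc: "incompressible X f"
  have "X = orbit f a" if "a \<in> X" for a
  proof -
    have "y \<in> X" if "y \<in> orbit f a" for y
      using that by induct (use inc \<open>a \<in> X\<close> in \<open>auto simp: incompressible_def\<close>)
    moreover have "f ` orbit f a \<subseteq> orbit f a"
      by (auto intro: orbit.step)
    ultimately show ?thesis
      using inc orbit_nonempty[of f a] unfolding incompressible_def by blast
  qed
  then show "cyclic_on f X"
    using assms by (simp add: cyclic_on_alldef)
next
  assume cyc: "cyclic_on f X"
  have "X \<subseteq> J" if J: "J \<noteq> {}" "J \<subseteq> X" "f ` J \<subseteq> J" for J
  proof -
    obtain a where a: "a \<in> J" using J by blast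
    have "y \<in> J" if "y \<in> orbit f a" for y
      using that by induct (use a J in auto)
    with orbit_cyclic_eq3[OF cyc] a J show ?thesis by blast
  qed
  then have "\<not> (\<exists>J. J \<noteq> {} \<and> J \<subset> X \<and> f ` J \<subseteq> J)"
    by (meson psubsetE)
  moreover have "f \<in> X \<rightarrow> X"
    using cyclic_on_inI[OF cyc] by blast
  ultimately show "incompressible X f"
    unfolding incompressible_def by blast
qed

lemma cyclic_on_enumeration:
  assumes "cyclic_on f X" "a \<in> X"
  shows "bij_betw (\<lambda>i. (f ^^ i) a) {..<card X} X" and "(f ^^ card X) a = a"
proof -
  \<comment> \<open>The least positive return time of \<open>a\<close>: the iterates below it are
    distinct and exhaust the orbit, so it equals \<open>card X\<close>.\<close>
  let ?p = "funpow_dist1 f a a"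
  have orb: "orbit f a = X" and a: "a \<in> orbit f a"
    using orbit_cyclic_eq3[OF assms] assms(2) by auto
  have bij: "bij_betw (\<lambda>i. (f ^^ i) a) {..<?p} X"
    using inj_on_funpow_dist1[OF a] orbit_conv_funpow_dist1[OF a] orb
    by (simp add: bij_betw_def atLeast0LessThan)
  then have card: "card X = ?p"
    using bij_betw_same_card by fastforce
  show "bij_betw (\<lambda>i. (f ^^ i) a) {..<card X} X"
    using bij unfolding card .
  show "(f ^^ card X) a = a"
    using funpow_dist1_prop[OF a] unfolding card .
qed

text \<open>After a choice of base points, \<open>h\<close> matches the \<open>i\<close>-th iterate
  of one with the \<open>i\<close>-th iterate of the other.\<close>

lemma cyclic_on_conjugate:
  assumes f: "cyclic_on f X" and g: "cyclic_on g Y" and card: "card X = card Y"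
  shows "\<exists>h. bij_betw h X Y \<and> (\<forall>x\<in>X. h (f x) = g (h x))"
proof -
  obtain a b where a: "a \<in> X" and b: "b \<in> Y"
    using f g by (auto simp: cyclic_on_def)
  let ?F = "\<lambda>i. (f ^^ i) a" and ?G = "\<lambda>i. (g ^^ i) b"
  note F = cyclic_on_enumeration[OF f a] and G = cyclic_on_enumeration[OF g b]
  define h where "h = ?G \<circ> inv_into {..<card X} ?F"
  have hF: "h (?F i) = ?G i" if "i < card X" for i
    using that bij_betw_inv_into_left[OF F(1)] by (simp add: h_def)
  \<comment> \<open>The bound includes \<open>card X\<close> because the successor of the last point
    has this index; there both enumerations return to their base points.\<close>
  have hF_le: "h (?F i) = ?G i" if "i \<le> card X" for i
  proof (cases "i = card X")
    case True
    have "0 < card X"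
      using a finite_cyclic_on[OF f] card_gt_0_iff by blast
    then show ?thesis
      using hF[of 0] F(2) G(2) card True by simp
  qed (use that hF in simp)
  have "bij_betw h X Y"
    unfolding h_def using bij_betw_trans[OF bij_betw_inv_into[OF F(1)]] G(1) card by simp
  moreover have "h (f x) = g (h x)" if "x \<in> X" for x
  proof -
    have "x \<in> ?F ` {..<card X}"
      using that bij_betw_imp_surj_on[OF F(1)] by simp
    then obtain i where i: "i < card X" "x = ?F i"
      by auto
    then show ?thesis
      using hF_le[of "Suc i"] hF[of i] by simp
  qed
  ultimately show ?thesis by blast
qed

lemma cyclic_on_cycle_of_list:
  assumes "cycle cs" "cs \<noteq> []"
  shows "cyclic_on (cycle_of_list cs) (set cs)"
proof -
  let ?f = "cycle_of_list cs"
  \<comment> \<open>Mapping the \<open>i\<close>-th power over \<open>cs\<close> rotates the list by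
    \<open>i\<close>; this compares the heads.\<close>
  have nth: "(?f ^^ i) (cs ! 0) = cs ! (i mod length cs)" for i
    using arg_cong[OF cyclic_rotation[OF assms(1), of i], of "\<lambda>xs. xs ! 0"] assms(2)
    by (simp add: nth_rotate)
  have "set cs \<subseteq> {(?f ^^ i) (cs ! 0) | i. True}"
    by (auto simp: in_set_conv_nth nth) (metis mod_less)
  \<comment> \<open>The left side includes the zeroth iterate, which lies in the orbit because
    \<open>?f\<close> is a permutation of finite support.\<close>
  also have "\<dots> = orbit ?f (cs ! 0)"
    using orbit_altdef_permutation[OF permutation_of_cycle] by metis
  finally have "set cs \<subseteq> orbit ?f (cs ! 0)" .
  moreover have "orbit ?f (cs ! 0) \<subseteq> set cs"
    using assms(2) by (intro permutes_orbit_subset[OF cycle_permutes]) simp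
  ultimately have "set cs = orbit ?f (cs ! 0)"
    by (rule subset_antisym)
  moreover have "cs ! 0 \<in> set cs"
    using assms(2) by simp
  ultimately show ?thesis
    by (intro cyclic_on_singleI)
qed

text \<open>A list of \<open>card X\<close> distinct entries from the finite set \<open>X\<close>
  exhausts it, so the cycle runs through all of \<open>X\<close>.\<close>

lemma cycle_of_length_card_imp_cyclic_on:
  assumes "finite X" "X \<noteq> {}" "cycle_of_length X (card X) f"
  shows "cyclic_on f X"
proof -
  obtain cs where cs: "cycle cs" "set cs \<subseteq> X" "length cs = card X" "f = cycle_of_list cs"
    using assms(3) unfolding cycle_of_length_def by blast
  then have "set cs = X"
    using card_subset_eq[OF assms(1)] distinct_card by metis
  with cs cyclic_on_cycle_of_list[of cs] assms(2) show ?thesis by auto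
qed

lemma ex_cycle_of_length_card:
  assumes "finite X"
  shows "\<exists>f. cycle_of_length X (card X) f"
proof -
  obtain cs where "set cs = X" "cycle cs"
    using finite_distinct_list[OF assms] by blast
  then show ?thesis
    unfolding cycle_of_length_def using distinct_card[of cs] by auto
qed

text \<open>Multiplying on the right by anything amounts to applying \<open>f\<close>, and a
  non-empty \<open>J\<close> inside \<open>X\<close> supplies a point to multiply by. Hence right
  ideals are the non-empty \<open>f\<close>-invariant subsets.\<close>

lemma right_ideal_simple_iff_incompressible:
  assumes closed: "\<And>x y. \<lbrakk>x \<in> X; y \<in> X\<rbrakk> \<Longrightarrow> m x y \<in> X"
    and m: "\<And>x y. \<lbrakk>x \<in> X; y \<in> X\<rbrakk> \<Longrightarrow> m x y = f x"
  shows "right_ideal_simple X m \<longleftrightarrow> incompressible X f"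
proof -
  have ideal: "right_ideal X m J \<longleftrightarrow> J \<noteq> {} \<and> J \<subseteq> X \<and> f ` J \<subseteq> J" for J
    unfolding right_ideal_def using m by (auto simp: subset_iff)
  moreover have "f \<in> X \<rightarrow> X"
    using closed m by fastforce
  ultimately show ?thesis
    unfolding right_ideal_simple_def incompressible_def ideal psubset_eq by auto
qed

context right_plonka_magma
begin

lemma right_ideal_same_translation:
  assumes "a \<in> X"
  shows "right_ideal X m {y \<in> X. \<forall>x\<in>X. m x y = m x a}"
  using assms by (auto simp: right_ideal_def closed right_absorb)

lemma right_ideal_simple_imp_op_of:
  assumes "right_ideal_simple X m"
  shows "\<exists>f. incompressible X f \<and> (\<forall>x\<in>X. \<forall>y\<in>X. m x y = op_of f x y)"
proof -
  have "m x y = m x a" if "a \<in> X" "x \<in> X" "y \<in> X" for a x y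
    using right_ideal_same_translation[OF \<open>a \<in> X\<close>] assms that
    unfolding right_ideal_simple_def by blast
  \<comment> \<open>On the diagonal no base point has to be chosen, so the empty carrier is no exception.\<close>
  then have m: "m x y = m x x" if "x \<in> X" "y \<in> X" for x y
    using that by blast
  have "incompressible X (\<lambda>x. m x x)"
    using right_ideal_simple_iff_incompressible[of X m "\<lambda>x. m x x"] closed m assms by blast
  moreover have "\<forall>x\<in>X. \<forall>y\<in>X. m x y = op_of (\<lambda>x. m x x) x y"
    unfolding op_of_def using m by blast
  ultimately show ?thesis by blast
qed

lemma right_ideal_simple_iff:
  "right_ideal_simple X m \<longleftrightarrow>
     finite X \<and> (\<exists>f. incompressible X f \<and> (\<forall>x\<in>X. \<forall>y\<in>X. m x y = op_of f x y))"
proof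
  assume "right_ideal_simple X m"
  then obtain f where f: "incompressible X f" "\<forall>x\<in>X. \<forall>y\<in>X. m x y = op_of f x y"
    using right_ideal_simple_imp_op_of by blast
  \<comment> \<open>For empty \<open>X\<close> this is immediate; otherwise \<open>f\<close> is
    cyclic on \<open>X\<close>, and a cyclic orbit is finite.\<close>
  moreover have "finite X"
    using f(1) incompressible_iff_cyclic_on[of X f] finite_cyclic_on[of f X] by auto
  ultimately show "finite X \<and> (\<exists>f. incompressible X f \<and> (\<forall>x\<in>X. \<forall>y\<in>X. m x y = op_of f x y))"
    by blast
next
  assume "finite X \<and> (\<exists>f. incompressible X f \<and> (\<forall>x\<in>X. \<forall>y\<in>X. m x y = op_of f x y))"
  then show "right_ideal_simple X m"
    using right_ideal_simple_iff_incompressible[of X m] closed unfolding op_of_def by blast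
qed

end

lemma right_plonka_magma_op_of:
  assumes "f \<in> X \<rightarrow> X"
  shows "right_plonka_magma X (op_of f)"
  using assms by unfold_locales (auto simp: op_of_def)

text \<open>Both operations depend on the left factor only, so a bijection conjugating the
  underlying self-maps is already an isomorphism.\<close>

lemma simple_right_plonka_magma_isomorphic:
  assumes "right_plonka_magma X m" "right_ideal_simple X m" "X \<noteq> {}"
    and f: "cyclic_on f Y" and card: "card X = card Y"
  shows "magma_isomorphic X m Y (op_of f)"
proof -
  from right_plonka_magma.right_ideal_simple_imp_op_of[OF assms(1,2)]
  obtain g where g: "incompressible X g"
      and m: "\<forall>x\<in>X. \<forall>y\<in>X. m x y = op_of g x y"
    by (elim exE conjE)
  have "cyclic_on g X"
    using g incompressible_iff_cyclic_on[OF \<open>X \<noteq> {}\<close>] by blast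
  then obtain h where "bij_betw h X Y" "\<forall>x\<in>X. h (g x) = f (h x)"
    using cyclic_on_conjugate[OF _ f card] by blast
  moreover have "\<forall>x\<in>X. \<forall>y\<in>X. h (m x y) = op_of f (h x) (h y)"
    using m calculation(2) by (simp add: op_of_def)
  ultimately show ?thesis
    unfolding magma_isomorphic_def by blast
qed

theorem theorem3p23:
  shows "(\<forall>(X :: 'a set) m. right_plonka_magma X m \<longrightarrow>
            (right_ideal_simple X m \<longleftrightarrow>
               finite X \<and> (\<exists>f. incompressible X f \<and> (\<forall>x\<in>X. \<forall>y\<in>X. m x y = op_of f x y)))) \<and>
         (\<forall>(n :: nat) (X :: 'a set). n > 0 \<and> finite X \<and> card X = n \<longrightarrow>
            (\<exists>f. cycle_of_length X n f) \<and>
            (\<forall>f. cycle_of_length X n f \<longrightarrow>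
               right_plonka_magma X (op_of f) \<and> right_ideal_simple X (op_of f) \<and>
               (\<forall>m. right_plonka_magma X m \<and> right_ideal_simple X m \<longrightarrow>
                  magma_isomorphic X m X (op_of f))))"
proof (intro conjI allI impI)
  fix X :: "'a set" and m
  assume "right_plonka_magma X m"
  then show "right_ideal_simple X m \<longleftrightarrow>
      finite X \<and> (\<exists>f. incompressible X f \<and> (\<forall>x\<in>X. \<forall>y\<in>X. m x y = op_of f x y))"
    by (rule right_plonka_magma.right_ideal_simple_iff)
next
  fix n :: nat and X :: "'a set"
  assume "n > 0 \<and> finite X \<and> card X = n"
  then have fin: "finite X" and n: "card X = n" and ne: "X \<noteq> {}" by auto
  show "\<exists>f. cycle_of_length X n f"
    using ex_cycle_of_length_card[OF fin] unfolding n .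
  fix f
  assume "cycle_of_length X n f"
  then have cyc: "cyclic_on f X"
    using cycle_of_length_card_imp_cyclic_on[OF fin ne] unfolding n by blast
  then have inc: "incompressible X f"
    using incompressible_iff_cyclic_on[OF ne] by blast
  then have f: "f \<in> X \<rightarrow> X"
    by (simp add: incompressible_def)
  then show "right_plonka_magma X (op_of f)"
    by (rule right_plonka_magma_op_of)
  show "right_ideal_simple X (op_of f)"
    using right_ideal_simple_iff_incompressible[of X "op_of f" f] inc f
    by (auto simp: op_of_def)
  fix m
  assume "right_plonka_magma X m \<and> right_ideal_simple X m"
  then show "magma_isomorphic X m X (op_of f)"
    using simple_right_plonka_magma_isomorphic[OF _ _ ne cyc] by blast
qed

end
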